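(* Let $M$ be an $\omega$-complete effect monoid with no non-trivial zero divisors. Then either $M=\{0\}$, $M=\{0,1\}$ or $M\cong [0,1]$.
   Context: An effect algebra is a set $E$ with an element $0$, a partial binary operation $a+b$ (the partial sum), and a total complement $a\mapsto a^\perp$, such that: the sum is commutative and associative wherever defined, $a+0=a$, $a^\perp$ is the unique element with $a+a^\perp=1$ where $1:=0^\perp$, and $a+1$ defined implies $a=0$. The order is $a\le b$ iff $b=a+c$ for some $c$. An effect monoid is an effect algebra with an associative total multiplication $\cdot$ with unit $1$ which distributes over the partial sum on both sides. It is $\omega$-complete if every increasing sequence has a supremum. No non-trivial zero divisors means $a\cdot b=0$ implies $a=0$ or $b=0$. $[0,1]$ is the real unit interval with $x+y$ defined iff $x+y\le1$, complement $1-x$ and ordinary multiplication. *)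

theory Defs
  imports Complex_Main
begin

text \<open>
  The partial sum is option-valued: \<open>psum E a b = Some c\<close> means that \<open>a + b\<close> is defined and
  equals \<open>c\<close>, and \<open>None\<close> that it is undefined. Values of the operations on arguments outside
  the carrier are irrelevant.
\<close>

record 'a effect_algebra =
  carrier :: "'a set"
  zero :: 'a
  psum :: "'a \<Rightarrow> 'a \<Rightarrow> 'a option"
  compl :: "'a \<Rightarrow> 'a"

record 'a effect_monoid = "'a effect_algebra" +
  mult :: "'a \<Rightarrow> 'a \<Rightarrow> 'a"

definition one :: "('a, 'm) effect_algebra_scheme \<Rightarrow> 'a" where
  "one E = compl E (zero E)"

definition le :: "('a, 'm) effect_algebra_scheme \<Rightarrow> 'a \<Rightarrow> 'a \<Rightarrow> bool" where
  "le E a b \<longleftrightarrow> (\<exists>c \<in> carrier E. psum E a c = Some b)"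

locale effect_algebra =
  fixes E :: "('a, 'm) effect_algebra_scheme"
  assumes zero_closed: "zero E \<in> carrier E"
    and compl_closed: "a \<in> carrier E \<Longrightarrow> compl E a \<in> carrier E"
    and psum_closed:
      "\<lbrakk>a \<in> carrier E; b \<in> carrier E; psum E a b = Some c\<rbrakk> \<Longrightarrow> c \<in> carrier E"
    and psum_commute:
      "\<lbrakk>a \<in> carrier E; b \<in> carrier E\<rbrakk> \<Longrightarrow> psum E a b = psum E b a"
    and psum_assoc:
      "\<lbrakk>a \<in> carrier E; b \<in> carrier E; c \<in> carrier E\<rbrakk> \<Longrightarrow>
        Option.bind (psum E a b) (\<lambda>d. psum E d c) = Option.bind (psum E b c) (\<lambda>d. psum E a d)"
    and psum_zero: "a \<in> carrier E \<Longrightarrow> psum E a (zero E) = Some a"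
    and psum_compl: "a \<in> carrier E \<Longrightarrow> psum E a (compl E a) = Some (one E)"
    and compl_unique:
      "\<lbrakk>a \<in> carrier E; b \<in> carrier E; psum E a b = Some (one E)\<rbrakk> \<Longrightarrow> b = compl E a"
    and psum_one:
      "\<lbrakk>a \<in> carrier E; psum E a (one E) \<noteq> None\<rbrakk> \<Longrightarrow> a = zero E"

locale effect_monoid = effect_algebra M
  for M :: "('a, 'm) effect_monoid_scheme" +
  assumes mult_closed: "\<lbrakk>a \<in> carrier M; b \<in> carrier M\<rbrakk> \<Longrightarrow> mult M a b \<in> carrier M"
    and mult_assoc:
      "\<lbrakk>a \<in> carrier M; b \<in> carrier M; c \<in> carrier M\<rbrakk> \<Longrightarrow>
        mult M (mult M a b) c = mult M a (mult M b c)"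
    and mult_one_left: "a \<in> carrier M \<Longrightarrow> mult M (one M) a = a"
    and mult_one_right: "a \<in> carrier M \<Longrightarrow> mult M a (one M) = a"
    and mult_psum_distrib_left:
      "\<lbrakk>a \<in> carrier M; b \<in> carrier M; c \<in> carrier M; psum M b c = Some d\<rbrakk> \<Longrightarrow>
        psum M (mult M a b) (mult M a c) = Some (mult M a d)"
    and mult_psum_distrib_right:
      "\<lbrakk>a \<in> carrier M; b \<in> carrier M; c \<in> carrier M; psum M a b = Some d\<rbrakk> \<Longrightarrow>
        psum M (mult M a c) (mult M b c) = Some (mult M d c)"

definition is_supremum :: "('a, 'm) effect_algebra_scheme \<Rightarrow> 'a set \<Rightarrow> 'a \<Rightarrow> bool" where
  "is_supremum E A s \<longleftrightarrow> s \<in> carrier E \<and> (\<forall>a \<in> A. le E a s) \<and>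
    (\<forall>u \<in> carrier E. (\<forall>a \<in> A. le E a u) \<longrightarrow> le E s u)"

definition omega_complete :: "('a, 'm) effect_algebra_scheme \<Rightarrow> bool" where
  "omega_complete E \<longleftrightarrow>
    (\<forall>x :: nat \<Rightarrow> 'a. (\<forall>n. x n \<in> carrier E) \<and> (\<forall>n. le E (x n) (x (Suc n)))
      \<longrightarrow> (\<exists>s. is_supremum E (range x) s))"

definition effect_monoid_hom ::
  "('a, 'm) effect_monoid_scheme \<Rightarrow> ('b, 'n) effect_monoid_scheme \<Rightarrow> ('a \<Rightarrow> 'b) \<Rightarrow> bool" where
  "effect_monoid_hom M N f \<longleftrightarrow>
    (\<forall>a \<in> carrier M. f a \<in> carrier N) \<and>
    f (zero M) = zero N \<and> f (one M) = one N \<and>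
    (\<forall>a \<in> carrier M. f (compl M a) = compl N (f a)) \<and>
    (\<forall>a \<in> carrier M. \<forall>b \<in> carrier M. \<forall>c. psum M a b = Some c \<longrightarrow> psum N (f a) (f b) = Some (f c)) \<and>
    (\<forall>a \<in> carrier M. \<forall>b \<in> carrier M. f (mult M a b) = mult N (f a) (f b))"

text \<open>
  A bijective homomorphism need not reflect definedness of the partial sum, hence the inverse is
  required to be a homomorphism as well.
\<close>

definition effect_monoid_isomorphic ::
  "('a, 'm) effect_monoid_scheme \<Rightarrow> ('b, 'n) effect_monoid_scheme \<Rightarrow> bool" where
  "effect_monoid_isomorphic M N \<longleftrightarrow>
    (\<exists>f g. effect_monoid_hom M N f \<and> effect_monoid_hom N M g \<and>
      (\<forall>a \<in> carrier M. g (f a) = a) \<and> (\<forall>b \<in> carrier N. f (g b) = b))"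

definition unit_interval :: "real effect_monoid" where
  "unit_interval =
    \<lparr>carrier = {0..1},
     zero = 0,
     psum = (\<lambda>x y. if x + y \<le> 1 then Some (x + y) else None),
     compl = (\<lambda>x. 1 - x),
     mult = (*)\<rparr>"

lemma effect_monoid_unit_interval: "effect_monoid unit_interval"
proof -
  have left: "a * b + a * c \<le> 1" if "b + c \<le> 1" "0 \<le> a" "a \<le> 1" "0 \<le> b" "0 \<le> c" for a b c :: real
    using mult_le_one[of a "b + c"] that by (simp add: distrib_left)
  have right: "a * c + b * c \<le> 1" if "a + b \<le> 1" "0 \<le> c" "c \<le> 1" "0 \<le> a" "0 \<le> b" for a b c :: real
    using left[OF that] by (simp add: mult.commute)
  show ?thesis
    by unfold_locales
      (auto simp: unit_interval_def one_def algebra_simps mult_le_one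
        intro: left right split: if_splits Option.bind_split)
qed

end

theory Submission imports Defs begin

text \<open>
  For \<open>a, b \<in> M\<close> the increasing iteration \<open>m \<mapsto> m + (a - m) \<cdot> (b - m)\<close> has a supremum
  \<open>s \<le> a, b\<close> with \<open>(a - s) \<cdot> (b - s) = 0\<close>. Without zero divisors \<open>s\<close> is \<open>a\<close> or \<open>b\<close>, so \<open>M\<close> is
  totally ordered. If \<open>M\<close> has an element other than \<open>0\<close> and \<open>1\<close>, a similar iteration yields
  \<open>h\<close> with \<open>h + h = 1\<close>. The powers \<open>h\<^sup>n\<close> play the role of \<open>2\<^sup>-\<^sup>n\<close> and become arbitrarily small,
  hence \<open>x \<mapsto> Sup {k / 2\<^sup>n | k h\<^sup>n \<le> x}\<close> is an additive order embedding into \<open>[0,1]\<close>, which is onto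
  by completeness. It is multiplicative because \<open>x \<mapsto> x \<cdot> y\<close> composed with it is additive, and a
  nonnegative additive functional is determined by its value at \<open>1\<close>.
\<close>

text \<open>The error bound tends to zero. This turns estimates on the grid of mesh
  \<open>1 / 2 ^ n\<close> into equations.\<close>

lemma eq_if_dyadically_close:
  fixes a b c :: real
  assumes "\<And>n::nat. \<bar>a - b\<bar> \<le> c / 2 ^ n"
  shows "a = b"
proof -
  have "(\<lambda>n. c / 2 ^ n) \<longlonglongrightarrow> 0"
    using LIMSEQ_divide_realpow_zero[of 2 c] by simp
  then have "\<bar>a - b\<bar> \<le> 0"
    using assms by (intro LIMSEQ_le_const) auto
  then show ?thesis by simp
qed

section \<open>Partial sums, cancellation and order in effect algebras\<close>

context effect_algebra
begin

text \<open>A relational form of the partial sum that carries definedness and carrier membership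
  together, so that chains of reassociations need no separate side conditions.\<close>

definition is_sum :: "'a \<Rightarrow> 'a \<Rightarrow> 'a \<Rightarrow> bool" where
  "is_sum a b c \<longleftrightarrow> a \<in> carrier E \<and> b \<in> carrier E \<and> psum E a b = Some c"

lemma is_sum_closed:
  assumes "is_sum a b c"
  shows "a \<in> carrier E" "b \<in> carrier E" "c \<in> carrier E"
  using assms psum_closed unfolding is_sum_def by metis+

lemma one_closed: "one E \<in> carrier E"
  by (simp add: one_def compl_closed zero_closed)

lemma is_sum_commute: "is_sum a b c \<Longrightarrow> is_sum b a c"
  unfolding is_sum_def using psum_commute by metis

lemma is_sum_unique: "is_sum a b c \<Longrightarrow> is_sum a b d \<Longrightarrow> c = d"
  unfolding is_sum_def by simp

lemma is_sum_assoc: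
  assumes "is_sum a b d" "is_sum d c e"
  obtains f where "is_sum b c f" "is_sum a f e"
proof -
  have cl: "a \<in> carrier E" "b \<in> carrier E" "c \<in> carrier E"
    using assms is_sum_closed by metis+
  have "Option.bind (psum E b c) (\<lambda>d. psum E a d) = Some e"
    using psum_assoc[OF cl] assms unfolding is_sum_def by simp
  then obtain f where "psum E b c = Some f" "psum E a f = Some e"
    by (auto simp: bind_eq_Some_conv)
  then show thesis
    using that cl psum_closed unfolding is_sum_def by metis
qed

lemma is_sum_assoc':
  assumes "is_sum b c f" "is_sum a f e"
  obtains d where "is_sum a b d" "is_sum d c e"
  using is_sum_assoc[OF is_sum_commute[OF assms(1)] is_sum_commute[OF assms(2)]] is_sum_commute by metis

lemma is_sum_zero: "a \<in> carrier E \<Longrightarrow> is_sum a (zero E) a"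
  unfolding is_sum_def using psum_zero zero_closed by simp

lemma is_sum_compl: "a \<in> carrier E \<Longrightarrow> is_sum a (compl E a) (one E)"
  unfolding is_sum_def using psum_compl compl_closed by simp

lemma is_sum_one_imp_compl: "is_sum a b (one E) \<Longrightarrow> b = compl E a"
  unfolding is_sum_def using compl_unique by simp

lemma compl_compl: "a \<in> carrier E \<Longrightarrow> compl E (compl E a) = a"
  using is_sum_one_imp_compl[OF is_sum_commute[OF is_sum_compl]] by simp

text \<open>Adding \<open>compl E d\<close> on both sides exhibits \<open>b\<close> and
  \<open>c\<close> as complements of the same element, the sum of \<open>a\<close> and
  \<open>compl E d\<close>; complements are unique.\<close>

lemma is_sum_cancel:
  assumes "is_sum a b d" "is_sum a c d"
  shows "b = c"
proof -
  have d: "is_sum d (compl E d) (one E)"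
    using assms is_sum_closed is_sum_compl by metis
  obtain e where e: "is_sum a (compl E d) e" "is_sum b e (one E)"
    using is_sum_assoc[OF is_sum_commute[OF assms(1)] d] .
  obtain e' where e': "is_sum a (compl E d) e'" "is_sum c e' (one E)"
    using is_sum_assoc[OF is_sum_commute[OF assms(2)] d] .
  show ?thesis
    using e e' is_sum_unique is_sum_one_imp_compl is_sum_commute by metis
qed

text \<open>Two reassociations around one swap. With \<open>a = b\<close> and \<open>c = d\<close>
  it shows that a sum can be doubled once the sum of the doubles is defined.\<close>

lemma is_sum_medial:
  assumes "is_sum a b u" "is_sum c d v" "is_sum u v z"
  obtains p q where "is_sum a c p" "is_sum b d q" "is_sum p q z"
proof -
  obtain f where f: "is_sum b v f" "is_sum a f z"
    using is_sum_assoc[OF assms(1,3)] .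
  obtain q where q: "is_sum d b q" "is_sum c q f"
    using is_sum_assoc[OF assms(2) is_sum_commute[OF f(1)]] .
  obtain p where "is_sum a c p" "is_sum p q z"
    using is_sum_assoc'[OF q(2) f(2)] .
  then show thesis
    using that q is_sum_commute by metis
qed

text \<open>Adding 1 to \<open>a + b = 0\<close> and reassociating shows that \<open>a + 1\<close>
  is defined.\<close>

lemma is_sum_eq_zero: "is_sum a b (zero E) \<Longrightarrow> a = zero E"
proof -
  assume ab: "is_sum a b (zero E)"
  have "is_sum (zero E) (one E) (one E)"
    using is_sum_commute[OF is_sum_zero[OF one_closed]] .
  then obtain f where "is_sum a (one E) f"
    using is_sum_assoc[OF is_sum_commute[OF ab]] by metis
  then show ?thesis
    using psum_one unfolding is_sum_def by auto
qed

lemma le_iff: "a \<in> carrier E \<Longrightarrow> le E a b \<longleftrightarrow> (\<exists>c. is_sum a c b)"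
  unfolding le_def is_sum_def by metis

lemma is_sum_le:
  assumes "is_sum a b c"
  shows "le E a c" "le E b c"
  using assms is_sum_commute[OF assms] unfolding le_def is_sum_def by metis+

lemma leE:
  assumes "le E a b" "a \<in> carrier E"
  obtains c where "is_sum a c b"
  using assms le_iff by blast

lemma le_refl: "a \<in> carrier E \<Longrightarrow> le E a a"
  using is_sum_zero is_sum_le by metis

lemma zero_le: "a \<in> carrier E \<Longrightarrow> le E (zero E) a"
  using is_sum_zero is_sum_le by metis

lemma le_one: "a \<in> carrier E \<Longrightarrow> le E a (one E)"
  using is_sum_compl is_sum_le by metis

lemma le_trans:
  assumes "le E a b" "le E b c" "a \<in> carrier E"
  shows "le E a c"
proof -
  obtain d where d: "is_sum a d b" using assms leE by blast
  obtain e where "is_sum b e c" using assms d leE is_sum_closed by metis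
  then show ?thesis
    using d is_sum_assoc is_sum_le by metis
qed

text \<open>The two differences satisfy \<open>a + (d + e) = a\<close>, so \<open>d + e = 0\<close>
  by cancellation and \<open>d = 0\<close> by positivity.\<close>

lemma le_antisym:
  assumes "le E a b" "le E b a" "a \<in> carrier E"
  shows "a = b"
proof -
  obtain d where d: "is_sum a d b" using assms leE by blast
  obtain e where e: "is_sum b e a" using assms d leE is_sum_closed by metis
  obtain f where "is_sum d e f" "is_sum a f a"
    using is_sum_assoc[OF d e] .
  then have "d = zero E"
    using is_sum_cancel is_sum_zero assms(3) is_sum_eq_zero by metis
  then show ?thesis
    using d is_sum_zero assms(3) is_sum_unique by metis
qed

lemma le_zero: "le E a (zero E) \<Longrightarrow> a \<in> carrier E \<Longrightarrow> a = zero E"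
  using leE is_sum_eq_zero by metis

lemma is_sum_downward:
  assumes "is_sum a b c" "le E a' a" "a' \<in> carrier E"
  obtains c' where "is_sum a' b c'" "le E c' c"
proof -
  obtain d where "is_sum d a' a" using assms leE is_sum_commute by metis
  then obtain c' where "is_sum a' b c'" "is_sum d c' c"
    using is_sum_assoc[OF _ assms(1)] by metis
  then show thesis using that is_sum_le by metis
qed

lemma is_sum_mono:
  assumes "is_sum a b c" "is_sum a' b' c'" "le E a' a" "le E b' b"
  shows "le E c' c"
proof -
  have cl: "a' \<in> carrier E" "b' \<in> carrier E" "c' \<in> carrier E" using assms is_sum_closed by metis+
  obtain d where d: "is_sum a' b d" "le E d c"
    using is_sum_downward[OF assms(1,3) cl(1)] .
  obtain e where e: "is_sum b' a' e" "le E e d"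
    using is_sum_downward[OF is_sum_commute[OF d(1)] assms(4) cl(2)] .
  have "e = c'" using e(1) assms(2) is_sum_unique is_sum_commute by metis
  then show ?thesis using e(2) d(2) le_trans cl by metis
qed

lemma is_sum_le_cancel:
  assumes "is_sum a b c" "is_sum a b' c'" "le E c c'"
  shows "le E b b'"
proof -
  obtain d where "is_sum c d c'" using assms leE is_sum_closed by metis
  then obtain f where "is_sum b d f" "is_sum a f c'"
    using is_sum_assoc[OF assms(1)] by metis
  then show ?thesis using is_sum_cancel assms(2) is_sum_le by metis
qed

text \<open>This turns definedness of a sum into an order relation, to which the least-upper-bound
  property applies.\<close>

lemma le_compl_iff:
  assumes "a \<in> carrier E" "b \<in> carrier E"
  shows "le E a (compl E b) \<longleftrightarrow> (\<exists>c. is_sum a b c)"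
proof
  assume "le E a (compl E b)"
  then show "\<exists>c. is_sum a b c"
    using is_sum_downward[OF is_sum_commute[OF is_sum_compl[OF assms(2)]]] assms(1) by metis
next
  assume "\<exists>c. is_sum a b c"
  then obtain c where c: "is_sum b a c" using is_sum_commute by metis
  then have "is_sum c (compl E c) (one E)" using is_sum_closed is_sum_compl by metis
  then obtain f where "is_sum a (compl E c) f" "is_sum b f (one E)"
    using is_sum_assoc[OF c] by metis
  then show "le E a (compl E b)"
    using is_sum_one_imp_compl is_sum_le by metis
qed

text \<open>If \<open>e\<close> fits below every increment of an increasing sequence, then the supremum \<open>s\<close>
  satisfies \<open>s - e \<ge> s\<close>.\<close>

lemma increments_bounded_below_imp_zero:
  assumes "omega_complete E" "\<And>n. is_sum (x n) (y n) (x (Suc n))"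
    and "e \<in> carrier E" "\<And>n. le E e (y n)"
  shows "e = zero E"
proof -
  have xc: "x n \<in> carrier E" for n using assms(2) is_sum_closed by metis
  have "le E (x n) (x (Suc n))" for n using assms(2) is_sum_le by metis
  then obtain s where s: "is_supremum E (range x) s"
    using assms(1) xc unfolding omega_complete_def by blast
  have sc: "s \<in> carrier E" and xs: "\<And>n. le E (x n) s"
    and least: "\<And>u. u \<in> carrier E \<Longrightarrow> (\<And>n. le E (x n) u) \<Longrightarrow> le E s u"
    using s unfolding is_supremum_def by auto
  have "le E e (x (Suc 0))"
    using assms le_trans is_sum_le by metis
  then obtain t where t: "is_sum e t s"
    using xs leE le_trans assms(3) by metis
  have "le E (x n) t" for n
  proof -
    obtain c where c: "is_sum e (x n) c" "le E c (x (Suc n))"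
      using is_sum_downward[OF is_sum_commute[OF assms(2)] assms(4,3)] .
    then have "le E c s" using xs le_trans is_sum_closed by metis
    then show ?thesis using is_sum_le_cancel c(1) t by metis
  qed
  then have "le E s t" using least t is_sum_closed by metis
  then have "s = t" using t le_antisym is_sum_le sc by metis
  then show ?thesis
    using t is_sum_cancel is_sum_commute is_sum_zero sc by metis
qed

section \<open>Natural multiples of an element\<close>

text \<open>A relation instead of a function, because the \<open>k\<close>-fold sum of
  \<open>a\<close> may be undefined.\<close>

primrec multiple :: "nat \<Rightarrow> 'a \<Rightarrow> 'a \<Rightarrow> bool" where
  "multiple 0 a u \<longleftrightarrow> u = zero E"
| "multiple (Suc k) a u \<longleftrightarrow> (\<exists>v. multiple k a v \<and> is_sum a v u)"

lemma multiple_closed: "multiple k a u \<Longrightarrow> u \<in> carrier E"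
  by (cases k) (auto simp: zero_closed dest: is_sum_closed)

lemma multiple_unique: "multiple k a u \<Longrightarrow> multiple k a v \<Longrightarrow> u = v"
proof (induction k arbitrary: u v)
  case (Suc k)
  then show ?case using is_sum_unique by fastforce
qed simp

lemma multiple_1: "a \<in> carrier E \<Longrightarrow> multiple (Suc 0) a a"
  by (simp add: is_sum_zero)

lemma multiple_add:
  "multiple j a u \<Longrightarrow> multiple k a v \<Longrightarrow> is_sum u v w \<Longrightarrow> multiple (j + k) a w"
proof (induction j arbitrary: u w)
  case 0
  then show ?case using is_sum_commute is_sum_zero multiple_closed is_sum_unique
    by (metis add_0 multiple.simps(1))
next
  case (Suc j)
  then obtain u' where u': "multiple j a u'" "is_sum a u' u" by auto
  obtain f where "is_sum u' v f" "is_sum a f w"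
    using is_sum_assoc[OF u'(2) Suc.prems(3)] .
  then show ?case using Suc.IH u' Suc.prems by auto
qed

text \<open>The converse of \<open>multiple_add\<close>: definedness of a large multiple yields all
  smaller ones.\<close>

lemma multiple_split:
  "multiple (j + k) a w \<Longrightarrow> \<exists>u v. multiple j a u \<and> multiple k a v \<and> is_sum u v w"
proof (induction j arbitrary: w)
  case 0
  then have "is_sum (zero E) w w" using is_sum_commute[OF is_sum_zero] multiple_closed by metis
  then show ?case using 0 by auto
next
  case (Suc j)
  then obtain z where z: "multiple (j + k) a z" "is_sum a z w" by auto
  then obtain u v where uv: "multiple j a u" "multiple k a v" "is_sum u v z" using Suc.IH by blast
  then obtain d where "is_sum a u d" "is_sum d v w" using is_sum_assoc' z by metis
  then show ?case using uv by auto
qed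

lemma multiple_exists_mono:
  assumes "multiple k a u" "j \<le> k"
  obtains v where "multiple j a v"
  using assms multiple_split[of j "k - j" a u] by auto

lemma multiple_double:
  assumes "is_sum a a b"
  shows "multiple k b u \<Longrightarrow> multiple (2 * k) a u"
proof (induction k arbitrary: u)
  case (Suc k)
  then obtain v where v: "multiple k b v" "is_sum b v u" by auto
  then obtain f where "is_sum a v f" "is_sum a f u" using is_sum_assoc assms by metis
  then show ?case using Suc.IH[OF v(1)] by auto
qed simp

lemma multiple_le_imp_le:
  assumes "a \<noteq> zero E" "multiple j a u" "multiple k a v" "le E u v"
  shows "j \<le> k"
proof (rule ccontr)
  assume "\<not> j \<le> k"
  \<comment> \<open>Writing the excess as \<open>Suc i\<close> makes \<open>a\<close> itself a
    summand of the difference \<open>w\<close>, so that \<open>w = 0\<close> forces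
    \<open>a = 0\<close>.\<close>
  then obtain i where i: "j = Suc i + k"
    by (metis add.commute add_Suc less_imp_Suc_add not_le)
  then obtain w v' where w: "multiple (Suc i) a w" "multiple k a v'" "is_sum w v' u"
    using multiple_split assms(2) by blast
  then have v': "v' = v" using multiple_unique assms(3) by blast
  then have "v = u" using w(3) assms(4) le_antisym is_sum_le multiple_closed[OF assms(3)] by metis
  then have "w = zero E"
    using w(3) v' is_sum_cancel is_sum_commute is_sum_zero multiple_closed[OF assms(3)] by metis
  then show False using w(1) assms(1) is_sum_eq_zero by (metis multiple.simps(2))+
qed

end

section \<open>Distributivity and monotonicity of the product\<close>

context effect_monoid
begin

lemma is_sum_mult_left: "is_sum b c d \<Longrightarrow> a \<in> carrier M \<Longrightarrow> is_sum (mult M a b) (mult M a c) (mult M a d)"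
  using mult_psum_distrib_left mult_closed unfolding is_sum_def by metis

lemma is_sum_mult_right: "is_sum a b d \<Longrightarrow> c \<in> carrier M \<Longrightarrow> is_sum (mult M a c) (mult M b c) (mult M d c)"
  using mult_psum_distrib_right mult_closed unfolding is_sum_def by metis

lemma mult_mono_left: "le M b d \<Longrightarrow> b \<in> carrier M \<Longrightarrow> a \<in> carrier M \<Longrightarrow> le M (mult M a b) (mult M a d)"
  using leE is_sum_mult_left is_sum_le by metis

lemma mult_mono_right: "le M a d \<Longrightarrow> a \<in> carrier M \<Longrightarrow> c \<in> carrier M \<Longrightarrow> le M (mult M a c) (mult M d c)"
  using leE is_sum_mult_right is_sum_le by metis

lemma mult_le:
  assumes "a \<in> carrier M" "b \<in> carrier M"
  shows "le M (mult M a b) a" "le M (mult M a b) b"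
  using mult_mono_left[OF le_one] mult_mono_right[OF le_one] assms mult_one_right mult_one_left
  by metis+

end

section \<open>Totality of the order and existence of a half\<close>

locale omega_effect_domain = effect_monoid M
  for M :: "('a, 'm) effect_monoid_scheme" +
  assumes complete: "omega_complete M"
    and no_zero_divisors:
      "\<lbrakk>a \<in> carrier M; b \<in> carrier M; mult M a b = zero M\<rbrakk> \<Longrightarrow> a = zero M \<or> b = zero M"
begin

lemma incseq_supremum:
  assumes "\<And>n. x n \<in> carrier M" "\<And>n. le M (x n) (x (Suc n))"
  obtains s where "s \<in> carrier M" "\<And>n. le M (x n) s"
    "\<And>u. u \<in> carrier M \<Longrightarrow> (\<And>n. le M (x n) u) \<Longrightarrow> le M s u"
proof -
  obtain s where "is_supremum M (range x) s"
    using complete assms unfolding omega_complete_def by blast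
  then show thesis using that unfolding is_supremum_def by auto
qed

lemma le_total:
  assumes a: "a \<in> carrier M" and b: "b \<in> carrier M"
  shows "le M a b \<or> le M b a"
proof -
  \<comment> \<open>The product of the remainders \<open>p = a - m\<close> and
    \<open>q = b - m\<close> lies below each of them, so adding it to \<open>m\<close> stays below
    both \<open>a\<close> and \<open>b\<close>.\<close>
  have step: "\<exists>m'. (m' \<in> carrier M \<and> le M m' a \<and> le M m' b) \<and>
      (\<exists>p q. is_sum m p a \<and> is_sum m q b \<and> is_sum m (mult M p q) m')"
    if m: "m \<in> carrier M \<and> le M m a \<and> le M m b" for m
  proof -
    obtain p q where p: "is_sum m p a" and q: "is_sum m q b" using m leE by metis
    have cl: "p \<in> carrier M" "q \<in> carrier M" using p q is_sum_closed by metis+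
    note pq = mult_le[OF cl] and pqc = mult_closed[OF cl]
    obtain m' where m': "is_sum (mult M p q) m m'" "le M m' a"
      using is_sum_downward[OF is_sum_commute[OF p] pq(1) pqc] .
    obtain m'' where "is_sum (mult M p q) m m''" "le M m'' b"
      using is_sum_downward[OF is_sum_commute[OF q] pq(2) pqc] .
    then have "le M m' b" using m' is_sum_unique by metis
    then show ?thesis using m' p q is_sum_commute is_sum_closed by metis
  qed
  have "\<exists>x. \<forall>n. (x n \<in> carrier M \<and> le M (x n) a \<and> le M (x n) b) \<and>
      (\<exists>p q. is_sum (x n) p a \<and> is_sum (x n) q b \<and> is_sum (x n) (mult M p q) (x (Suc n)))"
  proof (rule dependent_nat_choice)
    show "\<exists>x. x \<in> carrier M \<and> le M x a \<and> le M x b"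
      using zero_le zero_closed a b by blast
  qed (use step in blast)
  then obtain x where xc: "\<And>n. x n \<in> carrier M" and xa: "\<And>n. le M (x n) a"
    and xb: "\<And>n. le M (x n) b"
    and "\<And>n. \<exists>p q. is_sum (x n) p a \<and> is_sum (x n) q b \<and> is_sum (x n) (mult M p q) (x (Suc n))"
    by auto
  then obtain P Q where P: "\<And>n. is_sum (x n) (P n) a" and Q: "\<And>n. is_sum (x n) (Q n) b"
    and x: "\<And>n. is_sum (x n) (mult M (P n) (Q n)) (x (Suc n))" by metis
  obtain s where s: "s \<in> carrier M" "\<And>n. le M (x n) s"
    "\<And>u. u \<in> carrier M \<Longrightarrow> (\<And>n. le M (x n) u) \<Longrightarrow> le M s u"
    using incseq_supremum[where x = x, OF xc is_sum_le(1)[OF x]] by metis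
  have "le M s a" "le M s b" using s(3) xa xb a b by auto
  then obtain p q where p: "is_sum s p a" and q: "is_sum s q b" using leE s by metis
  have cl: "p \<in> carrier M" "q \<in> carrier M" "P n \<in> carrier M" "Q n \<in> carrier M" for n
    using p q P Q is_sum_closed by metis+
  \<comment> \<open>Subtraction is antitone: \<open>x n \<le> s\<close> gives
    \<open>c - s \<le> c - x n\<close>.\<close>
  have anti: "le M r r'" if r: "is_sum s r c" "is_sum (x n) r' c" for r r' c n
  proof -
    obtain w where "is_sum w (x n) s" using s(2) xc leE is_sum_commute by metis
    then obtain f where "is_sum (x n) r f" "is_sum w f c"
      using is_sum_assoc[OF _ r(1)] is_sum_commute by metis
    then show ?thesis using is_sum_le_cancel r(2) is_sum_le by metis
  qed
  \<comment> \<open>The product of the remainders at the supremum fits below every increment of the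
    sequence, hence vanishes.\<close>
  have "le M (mult M p q) (mult M (P n) (Q n))" for n
    using mult_mono_left[OF anti[OF q Q] _ cl(1)] mult_mono_right[OF anti[OF p P] _ cl(4)]
      le_trans mult_closed cl by metis
  then have "mult M p q = zero M"
    using increments_bounded_below_imp_zero[where x = x, OF complete x] mult_closed cl by blast
  then have "p = zero M \<or> q = zero M" using no_zero_divisors cl by blast
  then have "a = s \<or> b = s" using p q s is_sum_zero is_sum_unique by metis
  then show ?thesis using \<open>le M s a\<close> \<open>le M s b\<close> by blast
qed

text \<open>Starting from some \<open>b \<noteq> 0\<close> with \<open>b + b\<close> defined, iterate \<open>t \<mapsto> t + b \<cdot> (1 - 2t)\<close>.\<close>

lemma exists_half:
  assumes a: "a \<in> carrier M" "a \<noteq> zero M" "a \<noteq> one M"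
  obtains h where "is_sum h h (one M)"
proof -
  have nz: "compl M a \<noteq> zero M"
    using a compl_compl by (metis one_def)
  \<comment> \<open>The smaller of \<open>a\<close> and its complement lies below its own
    complement, so it can be added to itself.\<close>
  obtain b c where bc: "is_sum b b c" "b \<noteq> zero M"
    using le_total[OF a(1) compl_closed[OF a(1)]]
  proof
    assume "le M a (compl M a)"
    then show thesis using that a le_compl_iff by metis
  next
    assume "le M (compl M a) a"
    then show thesis using that nz a le_compl_iff compl_closed compl_compl by metis
  qed
  have b: "b \<in> carrier M" "c \<in> carrier M" using bc is_sum_closed by metis+
  \<comment> \<open>With \<open>u = 2t\<close> and \<open>r = 1 - u\<close>, the double of
    \<open>b \<cdot> r\<close> is \<open>c \<cdot> r \<le> r\<close>. It therefore fits on top of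
    \<open>u\<close>, and the new point can again be doubled.\<close>
  have step: "\<exists>t'. (\<exists>u. is_sum t' t' u) \<and>
      (\<exists>u r. is_sum t t u \<and> is_sum u r (one M) \<and> is_sum t (mult M b r) t')"
    if t: "\<exists>u. is_sum t t u" for t
  proof -
    obtain u where u: "is_sum t t u" using t by blast
    have r: "is_sum (compl M u) u (one M)" "compl M u \<in> carrier M"
      using u is_sum_closed is_sum_compl is_sum_commute compl_closed by metis+
    have bb: "is_sum (mult M b (compl M u)) (mult M b (compl M u)) (mult M c (compl M u))"
      using is_sum_mult_right[OF bc(1) r(2)] .
    obtain z where "is_sum (mult M c (compl M u)) u z"
      using is_sum_downward[OF r(1) mult_le(2)[OF b(2) r(2)] mult_closed[OF b(2) r(2)]] .
    then have "is_sum u (mult M c (compl M u)) z" using is_sum_commute by metis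
    then obtain p q where "is_sum t (mult M b (compl M u)) p" "is_sum t (mult M b (compl M u)) q"
      "is_sum p q z" using is_sum_medial[OF u bb] by metis
    then show ?thesis using u r is_sum_unique is_sum_commute by metis
  qed
  have "\<exists>x. \<forall>n. (\<exists>u. is_sum (x n) (x n) u) \<and>
      (\<exists>u r. is_sum (x n) (x n) u \<and> is_sum u r (one M) \<and> is_sum (x n) (mult M b r) (x (Suc n)))"
  proof (rule dependent_nat_choice)
    show "\<exists>x u. is_sum x x u" using is_sum_zero zero_closed by metis
  qed (use step in blast)
  then obtain x U R where U: "\<And>n. is_sum (x n) (x n) (U n)" and R: "\<And>n. is_sum (U n) (R n) (one M)"
    and x: "\<And>n. is_sum (x n) (mult M b (R n)) (x (Suc n))" by metis
  have xc: "x n \<in> carrier M" for n using U is_sum_closed by metis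
  have xle: "le M (x n) (x (Suc n))" for n using x is_sum_le by metis
  have mono: "le M (x m) (x n)" if "m \<le> n" for m n
    using that by (induction rule: dec_induct) (use xc xle le_refl le_trans in blast)+
  obtain h where h: "h \<in> carrier M" "\<And>n. le M (x n) h"
    "\<And>u. u \<in> carrier M \<Longrightarrow> (\<And>n. le M (x n) u) \<Longrightarrow> le M h u"
    using incseq_supremum[where x = x, OF xc xle] by blast
  \<comment> \<open>Mixed indices are needed because the supremum is taken in one summand at a time:
    first \<open>h \<le> compl M (x n)\<close>, then, after swapping,
    \<open>h \<le> compl M h\<close>.\<close>
  have "\<exists>c. is_sum (x m) (x n) c" for m n
  proof -
    obtain c where "is_sum (x (max m n)) (x n) c"
      using is_sum_downward[OF U mono[of n "max m n"] xc] is_sum_commute by (metis max.cobounded2)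
    then show ?thesis
      using is_sum_downward[OF _ mono[of m "max m n"] xc] by (metis max.cobounded1)
  qed
  then have "le M h (compl M (x n))" for n
    using h(3) compl_closed le_compl_iff xc by metis
  then have "le M (x n) (compl M h)" for n
    using le_compl_iff xc h(1) is_sum_commute by metis
  then have "le M h (compl M h)" using h compl_closed by blast
  then obtain v where v: "is_sum h h v" using le_compl_iff h(1) by metis
  define r where "r = compl M v"
  have vr: "is_sum v r (one M)" unfolding r_def using v is_sum_closed is_sum_compl by metis
  have rc: "r \<in> carrier M" "R n \<in> carrier M" for n using vr R is_sum_closed by metis+
  \<comment> \<open>The defect \<open>r = 1 - 2h\<close> is below each \<open>R n = 1 - U n\<close>,
    since \<open>U n \<le> v\<close>. So \<open>b \<cdot> r\<close> bounds all increments from below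
    and must be zero.\<close>
  have "le M r (R n)" for n
  proof -
    have "le M (U n) v" using is_sum_mono[OF v U] h by metis
    then obtain f where "is_sum (U n) r f"
      using is_sum_downward[OF vr] U is_sum_closed by metis
    then have "le M r (compl M (U n))"
      using le_compl_iff is_sum_closed is_sum_commute by metis
    then show ?thesis using is_sum_one_imp_compl[OF R] by simp
  qed
  then have "le M (mult M b r) (mult M b (R n))" for n
    using mult_mono_left b rc by simp
  then have "mult M b r = zero M"
    using increments_bounded_below_imp_zero[where x = x, OF complete x mult_closed] b rc by simp
  then have "r = zero M" using no_zero_divisors b rc bc by blast
  then have "v = one M" using vr is_sum_zero is_sum_closed is_sum_unique by metis
  then show thesis using v that by blast
qed

end

section \<open>Powers of the half and dyadic approximation\<close>

locale halved_effect_domain = omega_effect_domain +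
  fixes h
  assumes half: "is_sum h h (one M)"
    and nontrivial: "one M \<noteq> zero M"
begin

primrec dyad :: "nat \<Rightarrow> 'a" where
  "dyad 0 = one M"
| "dyad (Suc n) = mult M h (dyad n)"

lemma half_closed: "h \<in> carrier M"
  using half is_sum_closed by metis

lemma dyad_closed: "dyad n \<in> carrier M"
  by (induction n) (auto simp: one_closed half_closed mult_closed)

lemma dyad_Suc: "is_sum (dyad (Suc n)) (dyad (Suc n)) (dyad n)"
  using is_sum_mult_right[OF half dyad_closed] mult_one_left dyad_closed by simp

text \<open>If a power of \<open>h\<close> vanished, so would its double, the preceding power, down
  to 1.\<close>

lemma dyad_nonzero: "dyad n \<noteq> zero M"
proof (induction n)
  case 0
  then show ?case using nontrivial by simp
next
  case (Suc n)
  then show ?case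
    using dyad_Suc[of n] is_sum_zero[OF zero_closed] is_sum_unique by metis
qed

lemma multiple_dyad_shift: "multiple k (dyad n) u \<Longrightarrow> multiple (2 ^ m * k) (dyad (n + m)) u"
proof (induction m)
  case (Suc m)
  then show ?case using multiple_double[OF dyad_Suc] by (simp add: mult.assoc)
qed simp

lemma multiple_dyad_one: "multiple (2 ^ n) (dyad n) (one M)"
  using multiple_dyad_shift[OF multiple_1[OF dyad_closed[of 0]], of n] by simp

lemma multiple_dyad_exists:
  assumes "k \<le> 2 ^ n"
  obtains u where "multiple k (dyad n) u"
  using multiple_exists_mono[OF multiple_dyad_one assms] .

text \<open>Both multiples are rewritten over the common unit \<open>dyad (n + m)\<close>, where the
  coefficients can be compared.\<close>

lemma multiple_dyad_mono:
  assumes "multiple j (dyad n) u" "multiple k (dyad m) v" "le M u v"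
  shows "real j / 2 ^ n \<le> real k / 2 ^ m"
proof -
  have "multiple (2 ^ m * j) (dyad (n + m)) u" "multiple (2 ^ n * k) (dyad (n + m)) v"
    using multiple_dyad_shift[OF assms(1)] multiple_dyad_shift[OF assms(2), of n]
    by (auto simp: add.commute)
  then have "2 ^ m * j \<le> 2 ^ n * k"
    using multiple_le_imp_le[OF dyad_nonzero] assms(3) by metis
  then have "real (2 ^ m * j) \<le> real (2 ^ n * k)"
    by (rule of_nat_mono)
  then show ?thesis by (simp add: field_simps)
qed

text \<open>The Archimedean property. Otherwise, by totality, \<open>x\<close> is below every power
  of \<open>h\<close>. These are the increments of the sequence \<open>1 - dyad n\<close>, so
  \<open>x = 0\<close>.\<close>

lemma dyad_le:
  assumes "x \<in> carrier M" "x \<noteq> zero M"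
  obtains n where "le M (dyad n) x"
proof (rule ccontr)
  assume "\<not> thesis"
  then have x: "le M x (dyad n)" for n
    using that le_total[OF assms(1) dyad_closed] by blast
  have "is_sum (compl M (dyad n)) (dyad (Suc n)) (compl M (dyad (Suc n)))" for n
  proof -
    have "is_sum (dyad n) (compl M (dyad n)) (one M)"
      using is_sum_compl dyad_closed by metis
    then obtain f where "is_sum (dyad (Suc n)) (compl M (dyad n)) f" "is_sum (dyad (Suc n)) f (one M)"
      using is_sum_assoc[OF dyad_Suc] by metis
    then show ?thesis using is_sum_one_imp_compl is_sum_commute by metis
  qed
  then show False
    using increments_bounded_below_imp_zero[of "\<lambda>n. compl M (dyad n)" "\<lambda>n. dyad (Suc n)" x] complete x assms
    by blast
qed

text \<open>Binary expansion: each refinement doubles \<open>k\<close> and adds 1 if the next power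
  of \<open>h\<close> fits into the remainder. The bound on \<open>r\<close> is not strict, so
  \<open>k\<close> need not be unique.\<close>

lemma dyad_floor:
  assumes "x \<in> carrier M"
  shows "\<exists>k u r. multiple k (dyad n) u \<and> is_sum u r x \<and> le M r (dyad n)"
proof (induction n)
  case 0
  have "multiple 0 (dyad 0) (zero M)" by simp
  then show ?case
    using is_sum_commute[OF is_sum_zero[OF assms]] le_one[OF assms] by (metis dyad.simps(1))
next
  case (Suc n)
  then obtain k u r where k: "multiple k (dyad n) u" "is_sum u r x" "le M r (dyad n)" by blast
  have r: "r \<in> carrier M" using k is_sum_closed by metis
  have k2: "multiple (2 * k) (dyad (Suc n)) u" using multiple_double[OF dyad_Suc k(1)] .
  consider "le M r (dyad (Suc n))" | "le M (dyad (Suc n)) r"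
    using le_total[OF r dyad_closed] by blast
  then show ?case
  proof cases
    case 1
    then show ?thesis using k k2 by blast
  next
    case 2
    then obtain r' where r': "is_sum (dyad (Suc n)) r' r" using leE dyad_closed by metis
    then obtain v where v: "is_sum u (dyad (Suc n)) v" "is_sum v r' x"
      using is_sum_assoc'[OF _ k(2)] by metis
    have "multiple (2 * k + Suc 0) (dyad (Suc n)) v"
      using multiple_add[OF k2 multiple_1[OF dyad_closed] v(1)] .
    \<comment> \<open>One copy of \<open>dyad (Suc n)\<close> is cancelled from
      \<open>r \<le> dyad n\<close>.\<close>
    moreover have "le M r' (dyad (Suc n))"
      using is_sum_le_cancel[OF r' dyad_Suc k(3)] .
    ultimately show ?thesis using v by blast
  qed
qed

section \<open>The additive map to the unit interval\<close>

definition lower_dyadics :: "'a \<Rightarrow> real set" where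
  "lower_dyadics x = {real k / 2 ^ n | k n u. multiple k (dyad n) u \<and> le M u x}"

definition measure_of :: "'a \<Rightarrow> real" where
  "measure_of x = Sup (lower_dyadics x)"

lemma lower_dyadics_nonempty: "x \<in> carrier M \<Longrightarrow> lower_dyadics x \<noteq> {}"
  unfolding lower_dyadics_def using zero_le multiple.simps(1) by blast

lemma lower_dyadics_le_one: "r \<in> lower_dyadics x \<Longrightarrow> r \<le> 1"
  unfolding lower_dyadics_def
  using multiple_dyad_mono[OF _ multiple_dyad_one] le_one multiple_closed by fastforce

lemma measure_of_ge:
  assumes "multiple k (dyad n) u" "le M u x"
  shows "real k / 2 ^ n \<le> measure_of x"
  unfolding measure_of_def
proof (rule cSup_upper)
  show "real k / 2 ^ n \<in> lower_dyadics x"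
    using assms unfolding lower_dyadics_def by blast
  show "bdd_above (lower_dyadics x)"
    using lower_dyadics_le_one by (rule bdd_aboveI)
qed

lemma measure_of_nonneg: "x \<in> carrier M \<Longrightarrow> 0 \<le> measure_of x"
  using measure_of_ge[of 0 0 "zero M"] zero_le by simp

lemma measure_of_le_one: "x \<in> carrier M \<Longrightarrow> measure_of x \<le> 1"
  unfolding measure_of_def
  using lower_dyadics_nonempty lower_dyadics_le_one by (rule cSup_least)

text \<open>The second assumption is conditional because the multiple may fail to exist when
  \<open>k > 2 ^ n\<close>; the claimed bound then exceeds 1.\<close>

lemma measure_of_le:
  assumes "x \<in> carrier M" "\<And>u. multiple k (dyad n) u \<Longrightarrow> le M x u"
  shows "measure_of x \<le> real k / 2 ^ n"
proof (cases "k \<le> 2 ^ n")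
  case True
  then obtain v where v: "multiple k (dyad n) v" using multiple_dyad_exists by metis
  have "r \<le> real k / 2 ^ n" if r: "r \<in> lower_dyadics x" for r
  proof -
    obtain j m u where u: "r = real j / 2 ^ m" "multiple j (dyad m) u" "le M u x"
      using r unfolding lower_dyadics_def by blast
    have "le M u v" using u v assms le_trans multiple_closed by metis
    then show ?thesis using multiple_dyad_mono u v by metis
  qed
  then show ?thesis
    unfolding measure_of_def using lower_dyadics_nonempty[OF assms(1)] by (rule cSup_least[rotated])
next
  case False
  then have "real (2 ^ n) \<le> real k" by (intro of_nat_mono) simp
  then have "1 \<le> real k / 2 ^ n" by (simp add: field_simps)
  then show ?thesis using measure_of_le_one[OF assms(1)] by linarith
qed

lemma le_multiple_Suc:
  assumes "multiple k (dyad n) u" "is_sum u r x" "le M r (dyad n)" "multiple (Suc k) (dyad n) w"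
  shows "le M x w"
proof -
  have "is_sum u (dyad n) w"
    using assms(1,4) multiple_unique is_sum_commute by (metis multiple.simps(2))
  then show ?thesis
    using is_sum_mono[OF _ assms(2) le_refl[OF is_sum_closed(1)[OF assms(2)]] assms(3)] by metis
qed

lemma measure_of_bounds:
  assumes "multiple k (dyad n) u" "is_sum u r x" "le M r (dyad n)"
  shows "real k / 2 ^ n \<le> measure_of x" "measure_of x \<le> real (Suc k) / 2 ^ n"
  by (rule measure_of_ge[OF assms(1) is_sum_le(1)[OF assms(2)]])
    (rule measure_of_le[OF is_sum_closed(3)[OF assms(2)] le_multiple_Suc[OF assms]])

text \<open>With floors \<open>k\<close> and \<open>l\<close> of the summands, both sides lie
  between \<open>(k + l) / 2 ^ n\<close> and \<open>(k + l + 2) / 2 ^ n\<close>.\<close>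

lemma measure_of_add:
  assumes "is_sum x y z"
  shows "measure_of z = measure_of x + measure_of y"
proof (rule eq_if_dyadically_close[where c = 2])
  fix n
  have cl: "x \<in> carrier M" "y \<in> carrier M" "z \<in> carrier M" using assms is_sum_closed by metis+
  obtain k u r where k: "multiple k (dyad n) u" "is_sum u r x" "le M r (dyad n)"
    using dyad_floor cl by metis
  obtain l v s where l: "multiple l (dyad n) v" "is_sum v s y" "le M s (dyad n)"
    using dyad_floor cl by metis
  have "u \<in> carrier M" "v \<in> carrier M" using k l is_sum_closed by metis+
  then obtain w where w: "is_sum u v w" "le M w z"
    using is_sum_downward[OF assms is_sum_le(1)[OF k(2)]] is_sum_le(1)[OF l(2)]
      is_sum_downward is_sum_commute le_trans is_sum_closed(3) by metis
  have lower: "real (k + l) / 2 ^ n \<le> measure_of z"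
    using measure_of_ge[OF multiple_add[OF k(1) l(1) w(1)] w(2)] .
  have "le M z t" if t: "multiple (Suc k + Suc l) (dyad n) t" for t
  proof -
    obtain p q where p: "multiple (Suc k) (dyad n) p" and q: "multiple (Suc l) (dyad n) q"
      and pq: "is_sum p q t" using multiple_split[OF t] by blast
    show ?thesis
      using is_sum_mono[OF pq assms le_multiple_Suc[OF k p] le_multiple_Suc[OF l q]] .
  qed
  then have upper: "measure_of z \<le> real (Suc k + Suc l) / 2 ^ n"
    by (rule measure_of_le[OF cl(3)])
  show "\<bar>measure_of z - (measure_of x + measure_of y)\<bar> \<le> 2 / 2 ^ n"
    using lower upper measure_of_bounds[OF k] measure_of_bounds[OF l]
    by (simp add: add_divide_distrib abs_le_iff)
qed

lemma measure_of_one: "measure_of (one M) = 1"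
  using measure_of_ge[OF multiple_dyad_one[of 0] le_refl[OF one_closed]]
    measure_of_le_one[OF one_closed] by simp

text \<open>If \<open>k\<close> is a floor of \<open>x\<close> at level \<open>n\<close>, both sides
  lie between \<open>k\<close> and \<open>k + 1\<close> times \<open>\<phi> (dyad n)\<close>, which
  equals \<open>\<phi> (one M) / 2 ^ n\<close>.\<close>

lemma additive_functional_unique:
  fixes \<phi> :: "'a \<Rightarrow> real"
  assumes nonneg: "\<And>a. a \<in> carrier M \<Longrightarrow> 0 \<le> \<phi> a"
    and add: "\<And>a b c. is_sum a b c \<Longrightarrow> \<phi> c = \<phi> a + \<phi> b"
    and x: "x \<in> carrier M"
  shows "\<phi> x = measure_of x * \<phi> (one M)"
proof (rule eq_if_dyadically_close[where c = "\<phi> (one M)"])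
  fix n
  have mult: "\<phi> u = real k * \<phi> a" if "multiple k a u" for k a u
    using that
  proof (induction k arbitrary: u)
    case 0
    then show ?case using add[OF is_sum_zero[OF zero_closed]] by simp
  next
    case (Suc k)
    then show ?case using add by (auto simp: algebra_simps)
  qed
  obtain k u r where k: "multiple k (dyad n) u" "is_sum u r x" "le M r (dyad n)"
    using dyad_floor x by metis
  have rc: "r \<in> carrier M" using k is_sum_closed by metis
  then obtain r' where r': "is_sum r r' (dyad n)" using k leE by metis
  have r: "0 \<le> \<phi> r" "\<phi> r \<le> \<phi> (dyad n)"
    using add[OF r'] nonneg rc is_sum_closed(2)[OF r'] by fastforce+
  have one: "\<phi> (one M) = 2 ^ n * \<phi> (dyad n)" using mult[OF multiple_dyad_one] by simp
  \<comment> \<open>The measure of \<open>x\<close> in units of \<open>1 / 2 ^ n\<close>.\<close>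
  define \<delta> where "\<delta> = measure_of x * 2 ^ n"
  have d: "real k \<le> \<delta>" "\<delta> \<le> real k + 1"
    unfolding \<delta>_def using measure_of_bounds[OF k] by (simp_all add: field_simps)
  have "\<phi> x = real k * \<phi> (dyad n) + \<phi> r" using add[OF k(2)] mult[OF k(1)] by simp
  moreover have "real k * \<phi> (dyad n) \<le> \<delta> * \<phi> (dyad n)"
    "\<delta> * \<phi> (dyad n) \<le> (real k + 1) * \<phi> (dyad n)"
    using d nonneg[OF dyad_closed] by (auto intro: mult_right_mono)
  ultimately have "\<bar>\<phi> x - \<delta> * \<phi> (dyad n)\<bar> \<le> \<phi> (dyad n)"
    using r by (simp add: algebra_simps abs_le_iff)
  then show "\<bar>\<phi> x - measure_of x * \<phi> (one M)\<bar> \<le> \<phi> (one M) / 2 ^ n"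
    by (simp add: one \<delta>_def algebra_simps)
qed

lemma measure_of_mult:
  assumes "x \<in> carrier M" "y \<in> carrier M"
  shows "measure_of (mult M x y) = measure_of x * measure_of y"
  using additive_functional_unique[of "\<lambda>x. measure_of (mult M x y)", OF _ _ assms(1)]
    measure_of_nonneg mult_closed measure_of_add is_sum_mult_right mult_one_left assms(2)
  by metis

lemma measure_of_compl:
  assumes "x \<in> carrier M"
  shows "measure_of (compl M x) = 1 - measure_of x"
  using measure_of_add[OF is_sum_compl[OF assms]] measure_of_one by simp

lemma measure_of_zero: "measure_of (zero M) = 0"
  using measure_of_add[OF is_sum_zero[OF zero_closed]] by simp

section \<open>Order embedding and surjectivity\<close>

lemma measure_of_pos:
  assumes "x \<in> carrier M" "x \<noteq> zero M"
  shows "0 < measure_of x"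
proof -
  obtain n where "le M (dyad n) x" using dyad_le assms by metis
  then have "real (Suc 0) / 2 ^ n \<le> measure_of x"
    by (rule measure_of_ge[OF multiple_1[OF dyad_closed]])
  then show ?thesis
    by (rule less_le_trans[rotated]) simp
qed

lemma measure_of_mono: "le M x y \<Longrightarrow> x \<in> carrier M \<Longrightarrow> measure_of x \<le> measure_of y"
  using measure_of_add measure_of_nonneg leE is_sum_closed(2)
  by (metis le_add_same_cancel1)

text \<open>For reflection, totality writes a counterexample as \<open>x = y + c\<close>; then
  \<open>c\<close> has measure at most 0, so \<open>c = 0\<close> by
  \<open>measure_of_pos\<close>.\<close>

lemma measure_of_le_iff:
  assumes "x \<in> carrier M" "y \<in> carrier M"
  shows "measure_of x \<le> measure_of y \<longleftrightarrow> le M x y"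
proof
  assume xy: "measure_of x \<le> measure_of y"
  show "le M x y"
  proof (rule ccontr)
    assume n: "\<not> le M x y"
    then obtain c where c: "is_sum y c x" using le_total assms leE by metis
    then have "measure_of c \<le> 0" using xy measure_of_add by fastforce
    then have "c = zero M" using measure_of_pos is_sum_closed(2)[OF c] by fastforce
    then have "y = x" using c is_sum_zero is_sum_unique assms by metis
    then show False using n le_refl assms by simp
  qed
qed (use measure_of_mono assms in blast)

lemma measure_of_inj:
  assumes "x \<in> carrier M" "y \<in> carrier M" "measure_of x = measure_of y"
  shows "x = y"
  using measure_of_le_iff assms le_antisym by (metis order_refl)

lemma measure_of_multiple:
  assumes "multiple k (dyad n) u"
  shows "measure_of u = real k / 2 ^ n"
  using measure_of_ge[OF assms le_refl] measure_of_le[of u k n] multiple_closed[OF assms]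
    multiple_unique[OF assms] le_refl by (metis antisym)

lemma measure_of_between:
  assumes "0 \<le> r" "r < s" "s \<le> 1"
  obtains u where "u \<in> carrier M" "r < measure_of u" "measure_of u < s"
proof -
  \<comment> \<open>The mesh \<open>1 / 2 ^ n\<close> is smaller than \<open>s - r\<close>, so the
    first grid point strictly above \<open>r\<close>, namely \<open>k / 2 ^ n\<close>, lies before
    \<open>s\<close>.\<close>
  obtain n where n: "1 / (s - r) < 2 ^ n"
    using real_arch_pow[of 2 "1 / (s - r)"] by auto
  define k where "k = nat (\<lfloor>r * 2 ^ n\<rfloor> + 1)"
  have k: "r * 2 ^ n < real k" "real k \<le> r * 2 ^ n + 1"
    using assms(1) unfolding k_def by (simp_all add: add.commute) linarith
  have "1 < (s - r) * 2 ^ n" using n assms(2) by (simp add: field_simps)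
  then have ks: "real k < s * 2 ^ n" using k by (simp add: algebra_simps)
  also have "\<dots> \<le> 2 ^ n" using assms(3) by simp
  finally have "k \<le> 2 ^ n"
    by (metis less_imp_le of_nat_le_iff of_nat_numeral of_nat_power)
  then obtain u where u: "multiple k (dyad n) u" using multiple_dyad_exists by metis
  show thesis
    using that[OF multiple_closed[OF u]] k ks measure_of_multiple[OF u] by (simp add: field_simps)
qed

lemma measure_of_surj:
  assumes "0 \<le> r" "r \<le> 1"
  obtains x where "x \<in> carrier M" "measure_of x = r"
proof -
  \<comment> \<open>The candidate preimage is the supremum of the dyadic truncations of
    \<open>r\<close>, realized in \<open>M\<close>.\<close>
  define k where "k n = nat \<lfloor>r * 2 ^ n\<rfloor>" for n :: nat
  have k: "real (k n) \<le> r * 2 ^ n" "r * 2 ^ n < real (k n) + 1" for n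
    unfolding k_def using assms(1) by (simp_all add: of_nat_nat)
  have "k n \<le> 2 ^ n" for n
  proof -
    have "r * 2 ^ n \<le> 1 * 2 ^ n" using assms(2) by (intro mult_right_mono) auto
    then have "real (k n) \<le> 2 ^ n" using k(1)[of n] by linarith
    then show ?thesis by (metis of_nat_le_iff of_nat_numeral of_nat_power)
  qed
  then have "\<forall>n. \<exists>u. multiple (k n) (dyad n) u" using multiple_dyad_exists by metis
  then obtain x where x: "\<And>n. multiple (k n) (dyad n) (x n)" by metis
  have xc: "x n \<in> carrier M" for n using x multiple_closed by blast
  have mx: "measure_of (x n) = real (k n) / 2 ^ n" for n using x measure_of_multiple by blast
  have "le M (x n) (x (Suc n))" for n
  proof -
    \<comment> \<open>A strict bound with \<open>+ 1\<close> between integers gives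
      \<open>2 * k n \<le> k (Suc n)\<close>.\<close>
    have "real (2 * k n) < real (k (Suc n) + 1)"
      using k(1)[of n] k(2)[of "Suc n"] by simp
    then have "2 * k n \<le> k (Suc n)" by linarith
    then have "real (2 * k n) \<le> real (k (Suc n))" by (rule of_nat_mono)
    then have "measure_of (x n) \<le> measure_of (x (Suc n))"
      by (simp add: mx field_simps)
    then show ?thesis using measure_of_le_iff xc by blast
  qed
  then obtain s where s: "s \<in> carrier M" "\<And>n. le M (x n) s"
    "\<And>u. u \<in> carrier M \<Longrightarrow> (\<And>n. le M (x n) u) \<Longrightarrow> le M s u"
    using incseq_supremum[where x = x, OF xc] by blast
  have lim: "(\<lambda>n. r - 1 / 2 ^ n) \<longlonglongrightarrow> r - 0"
    using LIMSEQ_divide_realpow_zero[of 2 1] by (intro tendsto_diff tendsto_const) simp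
  have "r - 1 / 2 ^ n \<le> measure_of s" for n
    using measure_of_mono[OF s(2)[of n] xc] k(2)[of n] by (simp add: mx field_simps)
  then have "r \<le> measure_of s"
    using LIMSEQ_le_const2[OF lim] by auto
  moreover have "\<not> r < measure_of s"
  proof
    assume "r < measure_of s"
    then obtain u where u: "u \<in> carrier M" "r < measure_of u" "measure_of u < measure_of s"
      using measure_of_between assms(1) measure_of_le_one s(1) by metis
    have "measure_of (x n) \<le> r" for n using k(1)[of n] by (simp add: mx field_simps)
    then have "le M (x n) u" for n
      using u measure_of_le_iff xc by (meson less_imp_le order_trans)
    then have "le M s u" using s(3) u by blast
    then show False using measure_of_mono s(1) u(3) by fastforce
  qed
  ultimately show thesis using that s(1) by force
qed

section \<open>The isomorphism and the trichotomy\<close>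

lemma isomorphic_unit_interval: "effect_monoid_isomorphic M unit_interval"
proof -
  define g where "g = inv_into (carrier M) measure_of"
  have inj: "inj_on measure_of (carrier M)" using measure_of_inj by (rule inj_onI)
  have img: "measure_of ` carrier M = {0..1}"
    using measure_of_nonneg measure_of_le_one measure_of_surj by (fastforce elim: measure_of_surj)
  have gf: "g (measure_of a) = a" if "a \<in> carrier M" for a
    unfolding g_def using inj that by simp
  have g: "g r \<in> carrier M" "measure_of (g r) = r" if "0 \<le> r" "r \<le> 1" for r
    using that img inv_into_into[of r measure_of "carrier M"]
      f_inv_into_f[of r measure_of "carrier M"] unfolding g_def by auto
  have eqI: "a = g r" if "a \<in> carrier M" "measure_of a = r" for a r
    using gf[OF that(1)] that(2) by simp
  have add: "measure_of c = measure_of a + measure_of b" "measure_of c \<le> 1"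
    if "a \<in> carrier M" "b \<in> carrier M" "psum M a b = Some c" for a b c
    using that measure_of_add[of a b c] measure_of_le_one[of c] psum_closed[of a b c]
    unfolding is_sum_def by auto
  have "effect_monoid_hom M unit_interval measure_of"
    unfolding effect_monoid_hom_def
    using measure_of_one
    by (auto simp: unit_interval_def one_def measure_of_nonneg measure_of_le_one measure_of_zero
        measure_of_compl measure_of_mult add(2) simp flip: add(1))
  moreover have "effect_monoid_hom unit_interval M g"
  proof -
    have "psum M (g a) (g b) = Some (g (a + b))"
      if ab: "0 \<le> a" "a \<le> 1" "0 \<le> b" "b \<le> 1" "a + b \<le> 1" for a b
    proof -
      \<comment> \<open>Definedness in \<open>M\<close> comes from order reflection:
        \<open>a \<le> 1 - b\<close> compares the measures of \<open>g a\<close> and of the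
        complement of \<open>g b\<close>.\<close>
      have "le M (g a) (compl M (g b))"
        using ab g compl_closed by (subst measure_of_le_iff[symmetric]) (auto simp: measure_of_compl)
      then obtain c where c: "is_sum (g a) (g b) c"
        using le_compl_iff g ab by metis
      then have "c = g (a + b)"
        using eqI is_sum_closed(3) measure_of_add g ab by metis
      then show ?thesis using c unfolding is_sum_def by simp
    qed
    moreover have "g 0 = zero M" "g 1 = one M"
      using eqI measure_of_zero measure_of_one zero_closed one_closed by metis+
    moreover have "g (1 - a) = compl M (g a)" if "0 \<le> a" "a \<le> 1" for a
      using eqI[of "compl M (g a)"] g[OF that] compl_closed measure_of_compl by simp
    moreover have "g (a * b) = mult M (g a) (g b)" if "0 \<le> a" "a \<le> 1" "0 \<le> b" "b \<le> 1" for a b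
      using eqI[of "mult M (g a) (g b)"] g that mult_closed measure_of_mult by simp
    ultimately show ?thesis
      unfolding effect_monoid_hom_def using g
      by (auto simp: unit_interval_def one_def split: if_splits)
  qed
  ultimately show ?thesis
    unfolding effect_monoid_isomorphic_def using gf g
    by (intro exI[of _ measure_of] exI[of _ g]) (auto simp: unit_interval_def)
qed

end

theorem theorem70:
  fixes M :: "'a effect_monoid"
  assumes "effect_monoid M"
    and "omega_complete M"
    and "\<And>a b. \<lbrakk>a \<in> carrier M; b \<in> carrier M; mult M a b = zero M\<rbrakk> \<Longrightarrow> a = zero M \<or> b = zero M"
  shows "carrier M = {zero M} \<or> carrier M = {zero M, one M} \<or>
    effect_monoid_isomorphic M unit_interval"
proof (cases "carrier M \<subseteq> {zero M, one M}")
  case True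
  interpret effect_monoid M by fact
  show ?thesis using True zero_closed one_closed by blast
next
  case False
  then obtain a where a: "a \<in> carrier M" "a \<noteq> zero M" "a \<noteq> one M" by blast
  interpret effect_monoid M by fact
  interpret omega_effect_domain M
    using assms(2,3) by unfold_locales
  obtain h where h: "is_sum h h (one M)" using exists_half[OF a] .
  \<comment> \<open>Otherwise \<open>a \<le> 1 = 0\<close> would give \<open>a = 0\<close>.\<close>
  have "one M \<noteq> zero M"
    using a le_one le_zero by metis
  with h interpret halved_effect_domain M h by unfold_locales
  show ?thesis using isomorphic_unit_interval by blast
qed

end
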